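(* Let $\mathcal{G} = \{\boldsymbol{x} \in \prod_{i=1}^{n} \mathcal{D}_i \mid g(\boldsymbol{x}) \leq b\}$, where $g(\boldsymbol{x}) = \sum_{j=1}^q g_j(\boldsymbol{x}_{H_j})$ and each $g_j:\mathbb{R}^{|H_j|} \to \mathbb{R}$ is a (possibly non-separable) function of the variables with indices in $H_j \subseteq [n]$. Let $\mathtt{D}$ be a decision diagram constructed by the relaxed-DD procedure (without merging, described in the context) for some sub-domain partitions $\mathcal{D}^j_i$, $j \in L_i$, $i \in [n]$. Then $\mathrm{conv}(\mathcal{G}) \subseteq \mathrm{conv}(\mathrm{Sol}(\mathtt{D}))$.
   Context: Notation: $[n]=\{1,\dots,n\}$; $\boldsymbol{x}_H$ is the sub-vector of $\boldsymbol{x}$ with indices in $H$; $\mathrm{conv}$ is the convex hull. Each variable is either continuous, with $\mathcal{D}_i=[\mathcal{D}_i\!\downarrow,\mathcal{D}_i\!\uparrow]\subset\mathbb{R}$ a bounded closed interval, or integer, with $\mathcal{D}_i=[\mathcal{D}_i\!\downarrow,\mathcal{D}_i\!\uparrow]\cap\mathbb{Z}$ for integer endpoints. Each $H_k$ is nonempty and $H_k^{\max}=\max_{l\in H_k} l$. Decision diagram (DD): a directed acyclic multigraph $\mathtt{D}=(\mathtt{U},\mathtt{A},\mathtt{l}(\cdot))$ with node layers $\mathtt{U}_1,\dots,\mathtt{U}_{n+1}$ and arc layers $\mathtt{A}_1,\dots,\mathtt{A}_n$. $\mathtt{U}_1=\{\mathtt{r}\}$ (root), $\mathtt{U}_{n+1}=\{\mathtt{t}\}$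 (terminal). Each arc in $\mathtt{A}_i$ goes from a node in $\mathtt{U}_i$ to a node in $\mathtt{U}_{i+1}$ and has a real label $\mathtt{l}(\mathtt{a})$; parallel arcs are allowed. Each $\mathtt{r}$-$\mathtt{t}$ path $(\mathtt{a}_1,\dots,\mathtt{a}_n)$ encodes the point $(\mathtt{l}(\mathtt{a}_1),\dots,\mathtt{l}(\mathtt{a}_n))\in\mathbb{R}^n$, and $\mathrm{Sol}(\mathtt{D})$ is the set of all points so encoded. Sub-domain partitions: for each $i\in[n]$, $L_i$ is a finite index set and $\mathcal{D}_i^j$, $j\in L_i$, are sets of the form $[\mathcal{D}_i^j\!\downarrow,\mathcal{D}_i^j\!\uparrow]$ (or $[\mathcal{D}_i^j\!\downarrow,\mathcal{D}_i^j\!\uparrow]\cap\mathbb{Z}$ if $x_i$ is integer) with $\bigcup_{j\in L_i}\mathcal{D}_i^j=\mathcal{D}_i$. Relative sub-domain: for a node $\mathtt{u}\in\mathtt{U}_i$ and $l<i$, let $\mathtt{A}_l(\mathtt{u})$ be the set of arcs of arc layer $l$ that lie on a path from the root to $\mathtt{u}$; then $\mathcal{D}_l(\mathtt{u})=[\min_{\mathtt{a}\in \mathtt{A}_l(\mathtt{u})}\mathtt{l}(\mathtt{a}),\ \max_{\mathtt{a}\in \mathtt{A}_l(\mathtt{u})}\mathtt{l}(\mathtt{a})]$. Relaxed-DD procedure (without merging). Create the root $\mathtt{r}$ with state value $\mathtt{s}(\mathtt{r})=0$ and the terminal $\mathtt{t}$. For $i=1,\dots,n$ in order, for each $\mathtt{u}\in\mathtt{U}_i$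 and each $j\in L_i$: for each $k\in[q]$, if $i=H_k^{\max}$, choose a real number $\eta_k$ with $\eta_k\le g_k(\boldsymbol{x}_{H_k})$ for all $x_i\in\mathcal{D}_i^j$ and all $x_l\in\mathcal{D}_l(\mathtt{u})$, $l\in H_k\setminus\{i\}$; otherwise set $\eta_k=0$. Put $\xi=\mathtt{s}(\mathtt{u})+\sum_{k=1}^q\eta_k$. If $i<n$, create in $\mathtt{U}_{i+1}$ a node $\mathtt{v}$ with state value $\mathtt{s}(\mathtt{v})=\xi$ (if such a node does not already exist) and add two arcs from $\mathtt{u}$ to $\mathtt{v}$ with labels $\mathcal{D}_i^j\!\downarrow$ and $\mathcal{D}_i^j\!\uparrow$. If $i=n$ and $\xi\le b$, add two arcs from $\mathtt{u}$ to $\mathtt{t}$ with labels $\mathcal{D}_n^j\!\downarrow$ and $\mathcal{D}_n^j\!\uparrow$. *)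

theory Defs
  imports "HOL-Analysis.Analysis" "HOL-Library.Function_Algebras" "Graph_Theory.Graph_Theory"
begin

text \<open>
  Vectors of \<open>\<real>\<^sup>n\<close> are functions \<^typ>\<open>nat \<Rightarrow> real\<close> that vanish outside the coordinates
  \<open>1, \<dots>, n\<close>.  Such functions form a subspace of the real vector space below, so the
  polymorphic operator \<^const>\<open>hull\<close> with \<^const>\<open>convex\<close> yields the usual convex hull in
  \<open>\<real>\<^sup>n\<close>.  The additive structure comes from \<^theory>\<open>HOL-Library.Function_Algebras\<close>.
\<close>

instantiation "fun" :: (type, real_vector) real_vector
begin

definition scaleR_fun :: "real \<Rightarrow> ('a \<Rightarrow> 'b) \<Rightarrow> 'a \<Rightarrow> 'b" where
  "scaleR_fun c f = (\<lambda>i. c *\<^sub>R f i)"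

instance
  by standard (auto simp: scaleR_fun_def fun_eq_iff scaleR_add_right scaleR_add_left)

end

lemma scaleR_fun_apply [simp]: "(c *\<^sub>R f) i = c *\<^sub>R f i"
  by (simp add: scaleR_fun_def)


section \<open>Decision diagrams\<close>

text \<open>\<^term>\<open>node_layer D i\<close> and \<^term>\<open>arc_layer D i\<close> are the layers \<open>U\<^sub>i\<close> and \<open>A\<^sub>i\<close>.\<close>

record ('u, 'a) dd =
  node_layer :: "nat \<Rightarrow> 'u set"
  arc_layer :: "nat \<Rightarrow> 'a set"
  src :: "'a \<Rightarrow> 'u"
  dst :: "'a \<Rightarrow> 'u"
  label :: "'a \<Rightarrow> real"
  root :: 'u
  terminal :: 'u

definition digraph_of :: "('u, 'a) dd \<Rightarrow> ('u, 'a) pre_digraph" where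
  "digraph_of D = \<lparr>verts = (\<Union>i. node_layer D i), arcs = (\<Union>i. arc_layer D i),
                   tail = src D, head = dst D\<rparr>"

definition decision_diagram :: "nat \<Rightarrow> ('u, 'a) dd \<Rightarrow> bool" where
  "decision_diagram n D \<longleftrightarrow>
     fin_digraph (digraph_of D) \<and> acyclic (arcs_ends (digraph_of D)) \<and>
     disjoint_family (node_layer D) \<and> disjoint_family (arc_layer D) \<and>
     (\<forall>i. i \<notin> {1..n + 1} \<longrightarrow> node_layer D i = {}) \<and>
     (\<forall>i. i \<notin> {1..n} \<longrightarrow> arc_layer D i = {}) \<and>
     node_layer D 1 = {root D} \<and> node_layer D (n + 1) = {terminal D} \<and>
     (\<forall>i\<in>{1..n}. \<forall>a\<in>arc_layer D i. src D a \<in> node_layer D i \<and> dst D a \<in> node_layer D (i + 1))"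

definition vec_of_list :: "real list \<Rightarrow> nat \<Rightarrow> real" where
  "vec_of_list ls = (\<lambda>i. if i \<in> {1..length ls} then ls ! (i - 1) else 0)"

text \<open>A walk of \<^theory>\<open>Graph_Theory.Arc_Walk\<close> is a list of arcs; in an acyclic graph all
  walks are paths.\<close>

definition Sol :: "('u, 'a) dd \<Rightarrow> (nat \<Rightarrow> real) set" where
  "Sol D = {vec_of_list (map (label D) p) | p.
              pre_digraph.awalk (digraph_of D) (root D) p (terminal D)}"

definition rel_arcs :: "('u, 'a) dd \<Rightarrow> nat \<Rightarrow> 'u \<Rightarrow> 'a set" where
  "rel_arcs D l u = {a \<in> arc_layer D l.
                       \<exists>p. pre_digraph.awalk (digraph_of D) (root D) p u \<and> a \<in> set p}"

definition rel_subdomain :: "('u, 'a) dd \<Rightarrow> nat \<Rightarrow> 'u \<Rightarrow> real set" where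
  "rel_subdomain D l u = {Min (label D ` rel_arcs D l u) .. Max (label D ` rel_arcs D l u)}"

definition add_node :: "nat \<Rightarrow> 'u \<Rightarrow> ('u, 'a) dd \<Rightarrow> ('u, 'a) dd" where
  "add_node i v D = D\<lparr>node_layer := (node_layer D)(i := insert v (node_layer D i))\<rparr>"

definition add_arc :: "nat \<Rightarrow> 'a \<Rightarrow> 'u \<Rightarrow> 'u \<Rightarrow> real \<Rightarrow> ('u, 'a) dd \<Rightarrow> ('u, 'a) dd" where
  "add_arc i a u v c D =
     D\<lparr>arc_layer := (arc_layer D)(i := insert a (arc_layer D i)),
       src := (src D)(a := u), dst := (dst D)(a := v), label := (label D)(a := c)\<rparr>"

definition fresh_arcs :: "('u, 'a) dd \<Rightarrow> 'a \<Rightarrow> 'a \<Rightarrow> bool" where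
  "fresh_arcs D a a' \<longleftrightarrow> a \<noteq> a' \<and> a \<notin> (\<Union>i. arc_layer D i) \<and> a' \<notin> (\<Union>i. arc_layer D i)"


section \<open>Variable domains and the feasible set\<close>

definition var_interval :: "bool \<Rightarrow> real \<Rightarrow> real \<Rightarrow> real set" where
  "var_interval is_int lo hi = (if is_int then {lo..hi} \<inter> \<int> else {lo..hi})"

text \<open>
  The sub-vector \<open>x\<^sub>H\<close> is \<^term>\<open>restrict x H\<close>, so that a function of the variables in \<open>H\<close> is
  a function on \<open>H \<rightarrow>\<^sub>E \<real>\<close>.
\<close>

definition feasible_set ::
  "nat \<Rightarrow> nat \<Rightarrow> (nat \<Rightarrow> nat set) \<Rightarrow> (nat \<Rightarrow> (nat \<Rightarrow> real) \<Rightarrow> real) \<Rightarrow> real \<Rightarrow>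
   (nat \<Rightarrow> bool) \<Rightarrow> (nat \<Rightarrow> real) \<Rightarrow> (nat \<Rightarrow> real) \<Rightarrow> (nat \<Rightarrow> real) set" where
  "feasible_set n q H g b is_int lo hi =
     {x. (\<forall>i. i \<notin> {1..n} \<longrightarrow> x i = 0) \<and>
         (\<forall>i\<in>{1..n}. x i \<in> var_interval (is_int i) (lo i) (hi i)) \<and>
         (\<Sum>k=1..q. g k (restrict x (H k))) \<le> b}"


section \<open>The relaxed-DD procedure\<close>

text \<open>
  \<open>slo i j\<close> and \<open>shi i j\<close> are the endpoints of the sub-domain \<open>j \<in> L i\<close> of variable \<open>i\<close>.
\<close>

context
  fixes n q :: nat
    and H :: "nat \<Rightarrow> nat set"
    and g :: "nat \<Rightarrow> (nat \<Rightarrow> real) \<Rightarrow> real"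
    and b :: real
    and is_int :: "nat \<Rightarrow> bool"
    and L :: "nat \<Rightarrow> 'l set"
    and slo shi :: "nat \<Rightarrow> 'l \<Rightarrow> real"
begin

definition valid_eta :: "('u, 'a) dd \<Rightarrow> nat \<Rightarrow> 'u \<Rightarrow> 'l \<Rightarrow> (nat \<Rightarrow> real) \<Rightarrow> bool" where
  "valid_eta D i u j \<eta> \<longleftrightarrow>
     (\<forall>k\<in>{1..q}.
        if i = Max (H k)
        then \<forall>x. x i \<in> var_interval (is_int i) (slo i j) (shi i j) \<and>
                 (\<forall>l\<in>H k - {i}. x l \<in> rel_subdomain D l u)
                 \<longrightarrow> \<eta> k \<le> g k (restrict x (H k))
        else \<eta> k = 0)"

text \<open>
  \<open>dd_run D s i T\<close>: the procedure can reach the partial diagram \<open>D\<close> with state values \<open>s\<close>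
  while processing layer \<open>i\<close>, where \<open>T\<close> holds the pairs \<open>(u, j)\<close> of layer \<open>i\<close> still to be
  processed.  Nodes and arcs are created under arbitrary unused names.
\<close>

inductive dd_run :: "('u, 'a) dd \<Rightarrow> ('u \<Rightarrow> real) \<Rightarrow> nat \<Rightarrow> ('u \<times> 'l) set \<Rightarrow> bool" where
  init:
    "\<lbrakk>root D \<noteq> terminal D;
      node_layer D = (\<lambda>_. {})(1 := {root D}, n + 1 := {terminal D});
      arc_layer D = (\<lambda>_. {});
      s (root D) = 0\<rbrakk>
     \<Longrightarrow> dd_run D s 1 ({root D} \<times> L 1)"
| old_node:
    "\<lbrakk>dd_run D s i T; i < n; (u, j) \<in> T; valid_eta D i u j \<eta>;
      v \<in> node_layer D (i + 1); s v = s u + (\<Sum>k=1..q. \<eta> k);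
      fresh_arcs D a a'\<rbrakk>
     \<Longrightarrow> dd_run (add_arc i a' u v (shi i j) (add_arc i a u v (slo i j) D)) s i (T - {(u, j)})"
| new_node:
    "\<lbrakk>dd_run D s i T; i < n; (u, j) \<in> T; valid_eta D i u j \<eta>;
      \<xi> = s u + (\<Sum>k=1..q. \<eta> k);
      \<not> (\<exists>v\<in>node_layer D (i + 1). s v = \<xi>);
      v \<notin> (\<Union>m. node_layer D m);
      fresh_arcs D a a'\<rbrakk>
     \<Longrightarrow> dd_run (add_arc i a' u v (shi i j) (add_arc i a u v (slo i j) (add_node (i + 1) v D)))
           (s(v := \<xi>)) i (T - {(u, j)})"
| next_layer:
    "\<lbrakk>dd_run D s i {}; i < n\<rbrakk> \<Longrightarrow> dd_run D s (i + 1) (node_layer D (i + 1) \<times> L (i + 1))"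
| last_feasible:
    "\<lbrakk>dd_run D s n T; (u, j) \<in> T; valid_eta D n u j \<eta>;
      s u + (\<Sum>k=1..q. \<eta> k) \<le> b;
      fresh_arcs D a a'\<rbrakk>
     \<Longrightarrow> dd_run (add_arc n a' u (terminal D) (shi n j) (add_arc n a u (terminal D) (slo n j) D))
           s n (T - {(u, j)})"
| last_infeasible:
    "\<lbrakk>dd_run D s n T; (u, j) \<in> T; valid_eta D n u j \<eta>;
      \<not> s u + (\<Sum>k=1..q. \<eta> k) \<le> b\<rbrakk>
     \<Longrightarrow> dd_run D s n (T - {(u, j)})"

definition relaxed_dd :: "('u, 'a) dd \<Rightarrow> bool" where
  "relaxed_dd D \<longleftrightarrow> (\<exists>s. dd_run D s n {})"

end

section \<open>The procedure produces decision diagrams\<close>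

lemma decision_diagramI:
  assumes fin: "finite (\<Union>i. node_layer D i)" "finite (\<Union>i. arc_layer D i)"
    and disj: "disjoint_family (node_layer D)" "disjoint_family (arc_layer D)"
    and empty: "\<And>i. i \<notin> {1..n + 1} \<Longrightarrow> node_layer D i = {}"
      "\<And>i. i \<notin> {1..n} \<Longrightarrow> arc_layer D i = {}"
    and ends: "node_layer D 1 = {root D}" "node_layer D (n + 1) = {terminal D}"
    and arcs: "\<And>i a. i \<in> {1..n} \<Longrightarrow> a \<in> arc_layer D i \<Longrightarrow>
      src D a \<in> node_layer D i \<and> dst D a \<in> node_layer D (i + 1)"
  shows "decision_diagram n D"
proof -
  define lay where "lay u = (THE i. u \<in> node_layer D i)" for u
  have lay: "lay u = i" if "u \<in> node_layer D i" for u i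
    unfolding lay_def using that disj(1)
    by (intro the_equality) (auto simp: disjoint_family_on_def)
  have in_range: "i \<in> {1..n}" if "a \<in> arc_layer D i" for a i
    using empty(2)[of i] that by blast
  have "arcs_ends (digraph_of D) \<subseteq> inv_image less_than lay"
  proof
    fix e assume "e \<in> arcs_ends (digraph_of D)"
    then obtain a i where a: "a \<in> arc_layer D i" "e = (src D a, dst D a)"
      by (auto simp: arcs_ends_def arc_to_ends_def digraph_of_def)
    then have "src D a \<in> node_layer D i \<and> dst D a \<in> node_layer D (i + 1)"
      using arcs[OF in_range] by blast
    with a show "e \<in> inv_image less_than lay"
      using lay by auto
  qed
  then have "acyclic (arcs_ends (digraph_of D))"
    by (meson wf_acyclic wf_inv_image wf_less_than wf_subset)
  moreover have "fin_digraph (digraph_of D)"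
    using fin arcs[OF in_range] by unfold_locales (auto simp: digraph_of_def)
  ultimately show ?thesis
    using assms unfolding decision_diagram_def by blast
qed

lemma decision_diagramD:
  assumes "decision_diagram n D"
  shows "finite (\<Union>i. node_layer D i)" "finite (\<Union>i. arc_layer D i)"
    and "disjoint_family (node_layer D)" "disjoint_family (arc_layer D)"
    and "\<And>i. i \<notin> {1..n + 1} \<Longrightarrow> node_layer D i = {}" "\<And>i. i \<notin> {1..n} \<Longrightarrow> arc_layer D i = {}"
    and "node_layer D 1 = {root D}" "node_layer D (n + 1) = {terminal D}"
    and "\<And>i a. i \<in> {1..n} \<Longrightarrow> a \<in> arc_layer D i \<Longrightarrow>
      src D a \<in> node_layer D i \<and> dst D a \<in> node_layer D (i + 1)"
proof -
  have "fin_digraph (digraph_of D)"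
    using assms by (simp add: decision_diagram_def)
  from fin_digraph.finite_verts[OF this] fin_digraph.finite_arcs[OF this]
  show "finite (\<Union>i. node_layer D i)" "finite (\<Union>i. arc_layer D i)"
    by (simp_all add: digraph_of_def)
qed (use assms in \<open>auto simp: decision_diagram_def\<close>)

lemma decision_diagram_add_arc:
  assumes D: "decision_diagram n D"
    and "i \<in> {1..n}" "u \<in> node_layer D i" "v \<in> node_layer D (i + 1)"
    and "a \<notin> (\<Union>i. arc_layer D i)"
  shows "decision_diagram n (add_arc i a u v c D)"
proof (rule decision_diagramI)
  have "(\<Union>m. arc_layer (add_arc i a u v c D) m) \<subseteq> insert a (\<Union>m. arc_layer D m)"
    by (auto simp: add_arc_def split: if_splits)
  then show "finite (\<Union>m. arc_layer (add_arc i a u v c D) m)"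
    using decision_diagramD(2)[OF D] by (meson finite_insert finite_subset)
  show "disjoint_family (arc_layer (add_arc i a u v c D))"
    using decision_diagramD(4)[OF D] assms(5)
    by (auto simp: add_arc_def disjoint_family_on_def)
  show "src (add_arc i a u v c D) e \<in> node_layer (add_arc i a u v c D) m \<and>
        dst (add_arc i a u v c D) e \<in> node_layer (add_arc i a u v c D) (m + 1)"
    if "m \<in> {1..n}" "e \<in> arc_layer (add_arc i a u v c D) m" for m e
    using that decision_diagramD(9)[OF D, of m e] assms
    by (auto simp: add_arc_def split: if_splits)
qed (use decision_diagramD[OF D] assms(2) in \<open>auto simp: add_arc_def\<close>)

lemma decision_diagram_add_node:
  assumes D: "decision_diagram n D"
    and "1 < i" "i \<le> n" "v \<notin> (\<Union>m. node_layer D m)"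
  shows "decision_diagram n (add_node i v D)"
proof (rule decision_diagramI)
  have "(\<Union>m. node_layer (add_node i v D) m) \<subseteq> insert v (\<Union>m. node_layer D m)"
    by (auto simp: add_node_def split: if_splits)
  then show "finite (\<Union>m. node_layer (add_node i v D) m)"
    using decision_diagramD(1)[OF D] by (meson finite_insert finite_subset)
  show "disjoint_family (node_layer (add_node i v D))"
    using decision_diagramD(3)[OF D] assms(4)
    by (auto simp: add_node_def disjoint_family_on_def)
  show "src (add_node i v D) e \<in> node_layer (add_node i v D) m \<and>
        dst (add_node i v D) e \<in> node_layer (add_node i v D) (m + 1)"
    if "m \<in> {1..n}" "e \<in> arc_layer (add_node i v D) m" for m e
    using that decision_diagramD(9)[OF D, of m e] by (auto simp: add_node_def)
qed (use decision_diagramD[OF D] assms(2,3) in \<open>auto simp: add_node_def\<close>)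

lemma decision_diagram_add_two_arcs:
  assumes "decision_diagram n D"
    and "i \<in> {1..n}" "u \<in> node_layer D i" "v \<in> node_layer D (i + 1)" "fresh_arcs D a a'"
  shows "decision_diagram n (add_arc i a' u v c' (add_arc i a u v c D))"
proof (intro decision_diagram_add_arc)
  show "a' \<notin> (\<Union>m. arc_layer (add_arc i a u v c D) m)"
    using assms(5) by (auto simp: fresh_arcs_def add_arc_def split: if_splits)
qed (use assms in \<open>auto simp: fresh_arcs_def add_arc_def\<close>)

lemma dd_run_decision_diagram:
  assumes "dd_run n q H g b is_int L slo shi D s i T" "n \<ge> 1"
  shows "decision_diagram n D \<and> i \<in> {1..n} \<and> T \<subseteq> node_layer D i \<times> L i"
  using assms
proof (induction rule: dd_run.induct)
  case (init D s)
  have "decision_diagram n D"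
    by (rule decision_diagramI)
       (use init in \<open>auto simp: disjoint_family_on_def split: if_splits\<close>)
  with init show ?case by auto
next
  case (old_node D s i T u j \<eta> v a a')
  then have "decision_diagram n
      (add_arc i a' u v (shi i j) (add_arc i a u v (slo i j) D))"
    by (intro decision_diagram_add_two_arcs) auto
  with old_node show ?case by (auto simp: add_arc_def)
next
  case (new_node D s i T u j \<eta> \<xi> v a a')
  then have "decision_diagram n (add_node (i + 1) v D)"
    by (intro decision_diagram_add_node) auto
  then have "decision_diagram n
      (add_arc i a' u v (shi i j) (add_arc i a u v (slo i j) (add_node (i + 1) v D)))"
    using new_node
    by (intro decision_diagram_add_two_arcs) (auto simp: add_node_def fresh_arcs_def)
  with new_node show ?case by (auto simp: add_arc_def add_node_def)
next
  case (next_layer D s i)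
  then show ?case by auto
next
  case (last_feasible D s T u j \<eta> a a')
  then have "decision_diagram n (add_arc n a' u (terminal D) (shi n j)
      (add_arc n a u (terminal D) (slo n j) D))"
    using decision_diagramD(8)[of n D]
    by (intro decision_diagram_add_two_arcs) auto
  with last_feasible show ?case by (auto simp: add_arc_def)
next
  case (last_infeasible D s T u j \<eta>)
  then show ?case by auto
qed

theorem relaxed_dd_decision_diagram:
  assumes "relaxed_dd n q H g b is_int L slo shi D" "n \<ge> 1"
  shows "decision_diagram n D"
  using assms dd_run_decision_diagram unfolding relaxed_dd_def by blast

end

theory Submission
  imports Defs
begin

text \<open>
  Fix a feasible \<open>x\<close> and, for each \<open>i\<close>, a sub-domain containing \<open>x\<^sub>i\<close>.  Following these
  sub-domains through the diagram, one keeps a node \<open>u\<close> of layer \<open>i\<close> such that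
  \<open>(x\<^sub>1, \<dots>, x\<^sub>i\<^sub>-\<^sub>1)\<close> is in the convex hull of the points encoded by the walks from the root
  to \<open>u\<close>, and the state value of \<open>u\<close> is at most the sum of those \<open>g\<^sub>k(x)\<close> whose variables all
  precede \<open>i\<close>.  The hull condition puts \<open>x\<^sub>l\<close> in the relative sub-domain of \<open>u\<close> for every
  \<open>l < i\<close>, so the lower bound used at \<open>u\<close> is valid for \<open>x\<close>; and \<open>x\<^sub>i\<close> is a convex
  combination of the labels of the two arcs created.  At the last layer the state value is
  at most \<open>g(x) \<le> b\<close>, so the arcs to the terminal are not suppressed.
\<close>

section \<open>Walks in decision diagrams\<close>

text \<open>\<open>cas\<close> recurses on the first arc, whereas here the root stays fixed and
  walks grow at the far end.\<close>

lemma awalk_snoc_iff: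
  "pre_digraph.awalk G u (p @ [a]) v \<longleftrightarrow>
     pre_digraph.awalk G u p (tail G a) \<and> a \<in> arcs G \<and> head G a = v"
proof -
  have "pre_digraph.cas G u (p @ [a]) v \<longleftrightarrow> pre_digraph.cas G u p (tail G a) \<and> head G a = v"
    by (induction p arbitrary: u) (auto simp: pre_digraph.cas.simps)
  then show ?thesis by (auto simp: pre_digraph.awalk_def)
qed

text \<open>Each arc climbs exactly one layer and layers are disjoint. The root sits in layer 1, so
  the arc at list index \<open>l\<close> belongs to arc layer \<open>Suc l\<close>.\<close>

lemma decision_diagram_awalk_arcs:
  assumes D: "decision_diagram n D"
    and p: "pre_digraph.awalk (digraph_of D) (root D) p u" and u: "u \<in> node_layer D i"
  shows "i = Suc (length p) \<and> (\<forall>l<length p. p ! l \<in> arc_layer D (Suc l))"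
  using p u
proof (induction p arbitrary: u i rule: rev_induct)
  case Nil
  then have "u = root D" by (simp add: pre_digraph.awalk_def pre_digraph.cas.simps)
  with decision_diagramD(3,7)[OF D] Nil have "i = 1"
    unfolding disjoint_family_on_def by blast
  then show ?case by simp
next
  case (snoc a p)
  then have walk: "pre_digraph.awalk (digraph_of D) (root D) p (src D a)"
    and a: "a \<in> (\<Union>m. arc_layer D m)" and head: "dst D a = u"
    by (auto simp: awalk_snoc_iff digraph_of_def)
  then obtain m where m: "a \<in> arc_layer D m" by blast
  with decision_diagramD(6)[OF D] have "m \<in> {1..n}" by blast
  from decision_diagramD(9)[OF D this m]
  have ends: "src D a \<in> node_layer D m" "u \<in> node_layer D (m + 1)" using head by auto
  with decision_diagramD(3)[OF D] snoc.prems(2) have "i = m + 1"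
    unfolding disjoint_family_on_def by blast
  with snoc.IH[OF walk ends(1)] m show ?case by (auto simp: nth_append less_Suc_eq)
qed

section \<open>Points encoded by walks from the root, and their behaviour as the diagram
  grows\<close>

definition walk_points :: "('u, 'a) dd \<Rightarrow> 'u \<Rightarrow> (nat \<Rightarrow> real) set" where
  "walk_points D u = {vec_of_list (map (label D) p) | p.
                        pre_digraph.awalk (digraph_of D) (root D) p u}"

lemma Sol_eq_walk_points: "Sol D = walk_points D (terminal D)"
  by (simp add: Sol_def walk_points_def)

lemma walk_points_root: "root D \<in> node_layer D i \<Longrightarrow> 0 \<in> walk_points D (root D)"
  unfolding walk_points_def
  by (auto intro!: exI[of _ "[]"] simp: vec_of_list_def pre_digraph.awalk_def
      pre_digraph.cas.simps digraph_of_def zero_fun_def)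

definition subdiagram :: "('u, 'a) dd \<Rightarrow> ('u, 'a) dd \<Rightarrow> bool" where
  "subdiagram D D' \<longleftrightarrow> root D' = root D \<and>
     (\<forall>i. node_layer D i \<subseteq> node_layer D' i) \<and> (\<forall>i. arc_layer D i \<subseteq> arc_layer D' i) \<and>
     (\<forall>i. \<forall>a\<in>arc_layer D i. src D' a = src D a \<and> dst D' a = dst D a \<and> label D' a = label D a)"

lemma subdiagram_add_node: "subdiagram D (add_node i v D)"
  by (auto simp: subdiagram_def add_node_def)

text \<open>\<open>add_arc\<close> overwrites the ends and label of its arc; freshness keeps this
  away from existing arcs.\<close>

lemma subdiagram_add_two_arcs:
  "fresh_arcs D a a' \<Longrightarrow> subdiagram D (add_arc i a' u v c' (add_arc i a u v c D))"
  by (fastforce simp: subdiagram_def add_arc_def fresh_arcs_def)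

text \<open>A walk of \<open>D\<close> is still a walk of \<open>D'\<close> with the same labels,
  since its arcs keep their ends and labels.\<close>

lemma walk_points_mono:
  assumes "subdiagram D D'"
  shows "walk_points D u \<subseteq> walk_points D' u"
proof
  fix y assume "y \<in> walk_points D u"
  then obtain p where y: "y = vec_of_list (map (label D) p)"
    and p: "pre_digraph.awalk (digraph_of D) (root D) p u"
    by (auto simp: walk_points_def)
  have old: "src D' a = src D a \<and> dst D' a = dst D a \<and> label D' a = label D a"
    if "a \<in> (\<Union>i. arc_layer D i)" for a
    using that assms by (auto simp: subdiagram_def)
  have arcs: "set p \<subseteq> (\<Union>i. arc_layer D i)"
    using p by (simp add: pre_digraph.awalk_def digraph_of_def)
  have cas: "pre_digraph.cas (digraph_of D') w p u \<longleftrightarrow> pre_digraph.cas (digraph_of D) w p u" for w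
    using arcs old
    by (induction p arbitrary: w) (auto simp: pre_digraph.cas.simps digraph_of_def)
  have "root D \<in> (\<Union>i. node_layer D' i)" "set p \<subseteq> (\<Union>i. arc_layer D' i)"
    using p arcs assms by (auto simp: pre_digraph.awalk_def digraph_of_def subdiagram_def; blast)+
  then have "pre_digraph.awalk (digraph_of D') (root D') p u"
    using p assms cas by (simp add: pre_digraph.awalk_def digraph_of_def subdiagram_def)
  moreover have "map (label D') p = map (label D) p"
    using arcs old by auto
  ultimately show "y \<in> walk_points D' u"
    unfolding walk_points_def y by (metis (mono_tags, lifting) mem_Collect_eq)
qed

text \<open>Written as a sum so that appending a fixed arc becomes a translation, which commutes
  with convex hulls.\<close>

lemma vec_of_list_snoc:
  "vec_of_list (ls @ [c]) = (\<lambda>m. if m = Suc (length ls) then c else 0) + vec_of_list ls"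
  by (auto simp: vec_of_list_def fun_eq_iff nth_append less_Suc_eq)

lemma walk_points_snoc:
  assumes D: "decision_diagram n D"
    and a: "a \<in> arc_layer D i" and y: "y \<in> walk_points D (src D a)"
  shows "(\<lambda>m. if m = i then label D a else 0) + y \<in> walk_points D (dst D a)"
proof -
  from y obtain p where y: "y = vec_of_list (map (label D) p)"
    and p: "pre_digraph.awalk (digraph_of D) (root D) p (src D a)"
    by (auto simp: walk_points_def)
  have "i \<in> {1..n}" using decision_diagramD(6)[OF D] a by blast
  then have "src D a \<in> node_layer D i" using decision_diagramD(9)[OF D] a by blast
  with decision_diagram_awalk_arcs[OF D p] have i: "i = Suc (length p)" by blast
  have "pre_digraph.awalk (digraph_of D) (root D) (p @ [a]) (dst D a)"
    using p a by (auto simp: awalk_snoc_iff digraph_of_def)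
  moreover have "(\<lambda>m. if m = i then label D a else 0) + y = vec_of_list (map (label D) (p @ [a]))"
    unfolding y by (simp add: vec_of_list_snoc i)
  ultimately show ?thesis unfolding walk_points_def by blast
qed

text \<open>Coordinate \<open>l\<close> of an encoded point is the label of an arc in
  \<open>rel_arcs D l u\<close>, hence lies between their extreme labels. This confines the points
  to a convex slab, and so also their hull.\<close>

lemma walk_points_hull_rel_subdomain:
  assumes D: "decision_diagram n D" and u: "u \<in> node_layer D i"
    and y: "y \<in> convex hull (walk_points D u)" and l: "1 \<le> l" "l < i"
  shows "y l \<in> rel_subdomain D l u"
proof -
  let ?box = "{z. z l \<in> rel_subdomain D l u}"
  have "walk_points D u \<subseteq> ?box"
  proof
    fix z assume "z \<in> walk_points D u"
    then obtain p where z: "z = vec_of_list (map (label D) p)"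
      and p: "pre_digraph.awalk (digraph_of D) (root D) p u"
      by (auto simp: walk_points_def)
    from decision_diagram_awalk_arcs[OF D p u] l
    have len: "l \<le> length p" and arc: "p ! (l - 1) \<in> arc_layer D l"
      by (auto dest: spec[of _ "l - 1"])
    have mem: "p ! (l - 1) \<in> rel_arcs D l u"
      using arc p len l by (auto simp: rel_arcs_def intro!: exI[of _ p])
    \<comment> \<open>Finiteness makes \<open>Min\<close> and \<open>Max\<close> genuine
      bounds.\<close>
    have "finite (rel_arcs D l u)"
      by (rule finite_subset[OF _ decision_diagramD(2)[OF D]]) (auto simp: rel_arcs_def)
    then have "label D (p ! (l - 1)) \<in> rel_subdomain D l u"
      using mem by (auto simp: rel_subdomain_def)
    then show "z \<in> ?box" using len l by (simp add: z vec_of_list_def)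
  qed
  moreover have "convex ?box"
  proof (rule convexI)
    fix y z :: "nat \<Rightarrow> real" and s t :: real
    assume "y \<in> ?box" "z \<in> ?box" and st: "0 \<le> s" "0 \<le> t" "s + t = 1"
    then have "y l \<in> rel_subdomain D l u" "z l \<in> rel_subdomain D l u" by auto
    moreover have "convex (rel_subdomain D l u)" by (simp add: rel_subdomain_def)
    ultimately have "s *\<^sub>R y l + t *\<^sub>R z l \<in> rel_subdomain D l u"
      using st by (rule_tac convexD)
    then show "s *\<^sub>R y + t *\<^sub>R z \<in> ?box" by simp
  qed
  ultimately show ?thesis using hull_minimal[of _ ?box convex] y by blast
qed

section \<open>Following a feasible point through the procedure\<close>

text \<open>The bound is strict because a node of layer \<open>i\<close> has only the first
  \<open>i - 1\<close> coordinates decided; the zero padding matches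
  \<open>vec_of_list\<close>.\<close>

definition initial_part :: "(nat \<Rightarrow> real) \<Rightarrow> nat \<Rightarrow> nat \<Rightarrow> real" where
  "initial_part x i = (\<lambda>m. if m < i then x m else 0)"

text \<open>Each of the two arcs translates the hull at \<open>u\<close> into the hull at
  \<open>v\<close>; mixing the two translates in the proportion that yields \<open>x i\<close> stays
  there by convexity.\<close>

lemma initial_part_Suc_in_hull:
  assumes D: "decision_diagram n D"
    and u: "initial_part x i \<in> convex hull (walk_points D u)"
    and a: "a \<in> arc_layer D i" "src D a = u" "dst D a = v"
    and a': "a' \<in> arc_layer D i" "src D a' = u" "dst D a' = v"
    and x: "label D a \<le> x i" "x i \<le> label D a'"
  shows "initial_part x (Suc i) \<in> convex hull (walk_points D v)"
proof -
  let ?e = "\<lambda>c m. if m = i then c else (0::real)"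
  have shift: "?e (label D e) + initial_part x i \<in> convex hull (walk_points D v)"
    if "e \<in> arc_layer D i" "src D e = u" "dst D e = v" for e
  proof -
    have "?e (label D e) + initial_part x i \<in> (+) (?e (label D e)) ` (convex hull (walk_points D u))"
      using u by (rule imageI)
    also have "\<dots> = convex hull ((+) (?e (label D e)) ` walk_points D u)"
      by (rule convex_hull_translation[symmetric])
    also have "\<dots> \<subseteq> convex hull (walk_points D v)"
      using walk_points_snoc[OF D that(1)] that by (intro hull_mono) auto
    finally show ?thesis .
  qed
  have "x i \<in> closed_segment (label D a) (label D a')"
    using x by (simp add: closed_segment_eq_real_ivl)
  then obtain t where t: "0 \<le> t" "t \<le> 1"
    and xi: "x i = (1 - t) *\<^sub>R label D a + t *\<^sub>R label D a'"
    by (auto simp: closed_segment_def)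
  have "(1 - t) *\<^sub>R (?e (label D a) + initial_part x i) + t *\<^sub>R (?e (label D a') + initial_part x i)
          \<in> convex hull (walk_points D v)"
    using shift a a' t by (intro convexD) auto
  moreover have "initial_part x (Suc i) =
      (1 - t) *\<^sub>R (?e (label D a) + initial_part x i) + t *\<^sub>R (?e (label D a') + initial_part x i)"
    by (auto simp: initial_part_def fun_eq_iff xi algebra_simps)
  ultimately show ?thesis by simp
qed

section \<open>State values along tracked nodes and the invariant of a run\<close>

context
  fixes n q :: nat
    and H :: "nat \<Rightarrow> nat set"
    and g :: "nat \<Rightarrow> (nat \<Rightarrow> real) \<Rightarrow> real"
    and x :: "nat \<Rightarrow> real"
  assumes H: "\<forall>k\<in>{1..q}. H k \<noteq> {} \<and> H k \<subseteq> {1..n}"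
begin

text \<open>The terms already charged on reaching layer \<open>i\<close>: term \<open>k\<close> is
  charged when its last variable is processed.\<close>

definition partial_value :: "nat \<Rightarrow> real" where
  "partial_value i = (\<Sum>k | k \<in> {1..q} \<and> Max (H k) < i. g k (restrict x (H k)))"

lemma Max_H: "k \<in> {1..q} \<Longrightarrow> Max (H k) \<in> {1..n}"
  using H by (meson Max_in finite_atLeastAtMost finite_subset subsetD)

lemma partial_value_1: "partial_value 1 = 0"
proof -
  have none: "{k. k \<in> {1..q} \<and> Max (H k) < 1} = {}" using Max_H by force
  show ?thesis unfolding partial_value_def none by simp
qed

lemma partial_value_Suc_n: "partial_value (Suc n) = (\<Sum>k=1..q. g k (restrict x (H k)))"
  unfolding partial_value_def using Max_H by (intro sum.cong) force+

text \<open>The terminal is never assigned a state value, hence the guard \<open>i \<le> n\<close>.\<close>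

definition tracks :: "('u, 'a) dd \<Rightarrow> ('u \<Rightarrow> real) \<Rightarrow> nat \<Rightarrow> 'u \<Rightarrow> bool" where
  "tracks D s i u \<longleftrightarrow> u \<in> node_layer D i \<and> initial_part x i \<in> convex hull (walk_points D u) \<and>
     (i \<le> n \<longrightarrow> s u \<le> partial_value i)"

lemma tracks_mono:
  assumes "tracks D s i u" "subdiagram D D'" "s' u = s u"
  shows "tracks D' s' i u"
  using assms hull_mono[OF walk_points_mono[OF assms(2)]]
  unfolding tracks_def subdiagram_def by auto

text \<open>Moving from \<open>i\<close> to \<open>Suc i\<close> adds exactly the terms with
  \<open>Max (H k) = i\<close>. Their other variables come earlier, so tracking makes
  \<open>x\<close> one of the points over which \<open>\<eta>\<close> is a lower bound.\<close>

lemma valid_eta_partial_value: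
  assumes D: "decision_diagram n D" and tr: "tracks D s i u" and "i \<le> n"
    and eta: "valid_eta q H g is_int slo shi D i u j \<eta>"
    and xi: "x i \<in> var_interval (is_int i) (slo i j) (shi i j)"
  shows "s u + (\<Sum>k=1..q. \<eta> k) \<le> partial_value (Suc i)"
proof -
  have bound: "\<eta> k \<le> g k (restrict x (H k))" if k: "k \<in> {1..q}" "Max (H k) = i" for k
  proof -
    have "x l \<in> rel_subdomain D l u" if "l \<in> H k - {i}" for l
    proof -
      have sub: "H k \<subseteq> {1..n}" using H k(1) by blast
      then have fin: "finite (H k)" by (rule finite_subset) simp
      have "1 \<le> l" using sub that by auto
      moreover have "l < i" using Max_ge[OF fin, of l] that k(2) by auto
      ultimately show ?thesis
        using walk_points_hull_rel_subdomain[OF D, of u i "initial_part x i" l] tr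
        by (auto simp: tracks_def initial_part_def)
    qed
    then show ?thesis using eta xi k by (auto simp: valid_eta_def dest!: bspec[OF _ k(1)])
  qed
  have zero: "\<eta> k = 0" if "k \<in> {1..q}" "Max (H k) \<noteq> i" for k
    using eta that unfolding valid_eta_def by (metis (no_types, lifting))
  have "(\<Sum>k=1..q. \<eta> k) = (\<Sum>k | k \<in> {1..q} \<and> Max (H k) = i. \<eta> k)"
    using zero by (intro sum.mono_neutral_right) auto
  also have "\<dots> \<le> (\<Sum>k | k \<in> {1..q} \<and> Max (H k) = i. g k (restrict x (H k)))"
    using bound by (intro sum_mono) auto
  finally have "s u + (\<Sum>k=1..q. \<eta> k) \<le>
      partial_value i + (\<Sum>k | k \<in> {1..q} \<and> Max (H k) = i. g k (restrict x (H k)))"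
    using tr \<open>i \<le> n\<close> by (simp add: tracks_def)
  also have "\<dots> = (\<Sum>k \<in> {k. k \<in> {1..q} \<and> Max (H k) < i} \<union> {k. k \<in> {1..q} \<and> Max (H k) = i}.
      g k (restrict x (H k)))"
    unfolding partial_value_def by (subst sum.union_disjoint) auto
  also have "\<dots> = partial_value (Suc i)"
    unfolding partial_value_def by (intro sum.cong) auto
  finally show ?thesis .
qed

lemma tracks_add_two_arcs:
  assumes D: "decision_diagram n D" and tr: "tracks D s i u" and i: "i \<in> {1..n}"
    and v: "v \<in> node_layer D (i + 1)" and fresh: "fresh_arcs D a a'"
    and xi: "c \<le> x i" "x i \<le> c'"
    and sv: "i < n \<longrightarrow> s v \<le> partial_value (Suc i)"
  shows "tracks (add_arc i a' u v c' (add_arc i a u v c D)) s (Suc i) v"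
proof -
  let ?D = "add_arc i a' u v c' (add_arc i a u v c D)"
  have "u \<in> node_layer D i" using tr by (simp add: tracks_def)
  then have D': "decision_diagram n ?D"
    by (rule decision_diagram_add_two_arcs[OF D i _ v fresh])
  have "tracks ?D s i u" using tr subdiagram_add_two_arcs[OF fresh] by (rule tracks_mono) simp
  then have "initial_part x i \<in> convex hull (walk_points ?D u)" by (simp add: tracks_def)
  then have "initial_part x (Suc i) \<in> convex hull (walk_points ?D v)"
    using fresh xi
    by (intro initial_part_Suc_in_hull[OF D', of x i u a v a'])
       (auto simp: add_arc_def fresh_arcs_def)
  then show ?thesis using v sv by (auto simp: tracks_def add_arc_def)
qed

text \<open>The disjunction is what survives each step: the pair following \<open>x\<close> is still
  pending, or its processing has already produced a tracking node in the next layer.\<close>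

lemma dd_run_tracks:
  assumes run: "dd_run n q H g b is_int L slo shi D s i T" and "n \<ge> 1"
    and x: "\<And>i. i \<in> {1..n} \<Longrightarrow> jx i \<in> L i"
      "\<And>i. i \<in> {1..n} \<Longrightarrow> x i \<in> var_interval (is_int i) (slo i (jx i)) (shi i (jx i))"
      "\<And>i. i \<notin> {1..n} \<Longrightarrow> x i = 0"
    and feasible: "(\<Sum>k=1..q. g k (restrict x (H k))) \<le> b"
  shows "\<exists>u. tracks D s i u \<and> ((u, jx i) \<in> T \<or> (\<exists>v. tracks D s (Suc i) v))"
  using run
proof (induction rule: dd_run.induct)
  case (init D s)
  \<comment> \<open>Index 0 is the only one below 1, and \<open>x 0 = 0\<close>; hence the initial
    part is the zero vector, encoded by the empty walk.\<close>
  then have "tracks D s 1 (root D)"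
    using walk_points_root[of D 1, THEN hull_inc, of convex] \<open>n \<ge> 1\<close> x(3)[of 0] partial_value_1
    by (auto simp: tracks_def initial_part_def zero_fun_def less_Suc_eq cong: if_cong)
  then show ?case using x(1)[of 1] \<open>n \<ge> 1\<close> by auto
next
  case (old_node D s i T u j \<eta> v a a')
  note D = dd_run_decision_diagram[OF old_node.hyps(1) \<open>n \<ge> 1\<close>]
  let ?D = "add_arc i a' u v (shi i j) (add_arc i a u v (slo i j) D)"
  have mono: "tracks ?D s m w" if "tracks D s m w" for m w
    using that subdiagram_add_two_arcs[OF old_node.hyps(7)] by (rule tracks_mono) simp
  from old_node.IH obtain w where w: "tracks D s i w"
    and cases: "(w, jx i) \<in> T \<or> (\<exists>v. tracks D s (Suc i) v)" by blast
  \<comment> \<open>Only this pair matters: removing any other leaves \<open>(w, jx i)\<close>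
    pending.\<close>
  have "\<exists>v. tracks ?D s (Suc i) v" if "(w, jx i) = (u, j)"
  proof -
    from that have xi: "x i \<in> var_interval (is_int i) (slo i j) (shi i j)"
      using x(2)[of i] D by auto
    with valid_eta_partial_value[of D s i u is_int slo shi j \<eta>] old_node.hyps w that D
    have "s v \<le> partial_value (Suc i)" by auto
    moreover have "slo i j \<le> x i" "x i \<le> shi i j"
      using xi by (auto simp: var_interval_def split: if_splits)
    ultimately show ?thesis using D w that old_node.hyps
      by (intro exI[of _ v] tracks_add_two_arcs) auto
  qed
  with w cases mono show ?case by blast
next
  case (new_node D s i T u j \<eta> \<xi> v a a')
  note D = dd_run_decision_diagram[OF new_node.hyps(1) \<open>n \<ge> 1\<close>]
  let ?E = "add_node (i + 1) v D"
  let ?D = "add_arc i a' u v (shi i j) (add_arc i a u v (slo i j) ?E)"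
  let ?s = "s(v := \<xi>)"
  have E: "decision_diagram n ?E"
    using D new_node.hyps by (intro decision_diagram_add_node) auto
  have fresh: "fresh_arcs ?E a a'"
    using new_node.hyps by (simp add: fresh_arcs_def add_node_def)
  have mono_E: "tracks ?E ?s m w" if "tracks D s m w" for m w
    using that new_node.hyps(7) by (intro tracks_mono[OF that subdiagram_add_node])
      (auto simp: tracks_def)
  have mono: "tracks ?D ?s m w" if "tracks D s m w" for m w
    using mono_E[OF that] subdiagram_add_two_arcs[OF fresh] by (rule tracks_mono) simp
  from new_node.IH obtain w where w: "tracks D s i w"
    and cases: "(w, jx i) \<in> T \<or> (\<exists>v. tracks D s (Suc i) v)" by blast
  have "\<exists>v. tracks ?D ?s (Suc i) v" if "(w, jx i) = (u, j)"
  proof -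
    from that have xi: "x i \<in> var_interval (is_int i) (slo i j) (shi i j)"
      using x(2)[of i] D by auto
    with valid_eta_partial_value[of D s i u is_int slo shi j \<eta>] new_node.hyps w that D
    have "\<xi> \<le> partial_value (Suc i)" by auto
    moreover have "slo i j \<le> x i" "x i \<le> shi i j"
      using xi by (auto simp: var_interval_def split: if_splits)
    moreover have "v \<in> node_layer ?E (i + 1)" by (simp add: add_node_def)
    ultimately show ?thesis using D E mono_E[OF w] that fresh
      by (intro exI[of _ v] tracks_add_two_arcs) auto
  qed
  with w cases mono show ?case by blast
next
  case (next_layer D s i)
  \<comment> \<open>No pair is pending, which excludes the first alternative.\<close>
  then obtain v where v: "tracks D s (Suc i) v" by blast
  then have "(v, jx (i + 1)) \<in> node_layer D (i + 1) \<times> L (i + 1)"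
    using x(1)[of "i + 1"] next_layer.hyps by (auto simp: tracks_def)
  with v show ?case by auto
next
  case (last_feasible D s T u j \<eta> a a')
  note D = dd_run_decision_diagram[OF last_feasible.hyps(1) \<open>n \<ge> 1\<close>]
  let ?D = "add_arc n a' u (terminal D) (shi n j) (add_arc n a u (terminal D) (slo n j) D)"
  have mono: "tracks ?D s m w" if "tracks D s m w" for m w
    using that subdiagram_add_two_arcs[OF last_feasible.hyps(5)] by (rule tracks_mono) simp
  from last_feasible.IH obtain w where w: "tracks D s n w"
    and cases: "(w, jx n) \<in> T \<or> (\<exists>v. tracks D s (Suc n) v)" by blast
  have "\<exists>v. tracks ?D s (Suc n) v" if "(w, jx n) = (u, j)"
  proof -
    from that have "x n \<in> var_interval (is_int n) (slo n j) (shi n j)"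
      using x(2)[of n] D by auto
    then have "slo n j \<le> x n" "x n \<le> shi n j"
      by (auto simp: var_interval_def split: if_splits)
    moreover have "terminal D \<in> node_layer D (n + 1)"
      using decision_diagramD(8)[of n D] D by simp
    \<comment> \<open>Here \<open>i = n\<close>, so the state condition on the target holds
      vacuously.\<close>
    ultimately show ?thesis using D w that last_feasible.hyps
      by (intro exI[of _ "terminal D"] tracks_add_two_arcs) auto
  qed
  with w cases mono show ?case by blast
next
  case (last_infeasible D s T u j \<eta>)
  note D = dd_run_decision_diagram[OF last_infeasible.hyps(1) \<open>n \<ge> 1\<close>]
  from last_infeasible.IH obtain w where w: "tracks D s n w"
    and cases: "(w, jx n) \<in> T \<or> (\<exists>v. tracks D s (Suc n) v)" by blast
  \<comment> \<open>The pair following \<open>x\<close> cannot be discarded: its value is at most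
    the full sum at \<open>x\<close>, hence at most \<open>b\<close>.\<close>
  have "(w, jx n) \<noteq> (u, j)"
  proof
    assume eq: "(w, jx n) = (u, j)"
    with x(2)[of n] D have "x n \<in> var_interval (is_int n) (slo n j) (shi n j)" by auto
    with valid_eta_partial_value[of D s n u is_int slo shi j \<eta>] last_infeasible.hyps w eq D
    have "s u + (\<Sum>k=1..q. \<eta> k) \<le> b" using feasible partial_value_Suc_n by auto
    with last_infeasible.hyps show False by simp
  qed
  with w cases show ?case by blast
qed

end

theorem proposition3:
  fixes n q :: nat
    and H :: "nat \<Rightarrow> nat set"
    and g :: "nat \<Rightarrow> (nat \<Rightarrow> real) \<Rightarrow> real"
    and b :: real
    and is_int :: "nat \<Rightarrow> bool"
    and lo hi :: "nat \<Rightarrow> real"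
    and L :: "nat \<Rightarrow> 'l set"
    and slo shi :: "nat \<Rightarrow> 'l \<Rightarrow> real"
    and D :: "('u, 'a) dd"
  assumes "n \<ge> 1"
    and "\<forall>k\<in>{1..q}. H k \<noteq> {} \<and> H k \<subseteq> {1..n}"
    and "\<forall>i\<in>{1..n}. is_int i \<longrightarrow> lo i \<in> \<int> \<and> hi i \<in> \<int>"
    and "\<forall>i\<in>{1..n}. finite (L i)"
    and "\<forall>i\<in>{1..n}. (\<Union>j\<in>L i. var_interval (is_int i) (slo i j) (shi i j))
                       = var_interval (is_int i) (lo i) (hi i)"
    and "relaxed_dd n q H g b is_int L slo shi D"
  shows "convex hull (feasible_set n q H g b is_int lo hi) \<subseteq> convex hull (Sol D)"
proof (rule hull_minimal)
  show "feasible_set n q H g b is_int lo hi \<subseteq> convex hull (Sol D)"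
  proof
    fix x assume x: "x \<in> feasible_set n q H g b is_int lo hi"
    \<comment> \<open>The sub-domains cover each domain, so one containing \<open>x i\<close> can be
      chosen in every layer.\<close>
    then have "\<forall>i\<in>{1..n}. \<exists>j\<in>L i. x i \<in> var_interval (is_int i) (slo i j) (shi i j)"
      using assms(5) unfolding feasible_set_def by blast
    then obtain jx where jx: "\<And>i. i \<in> {1..n} \<Longrightarrow> jx i \<in> L i"
      "\<And>i. i \<in> {1..n} \<Longrightarrow> x i \<in> var_interval (is_int i) (slo i (jx i)) (shi i (jx i))"
      by metis
    obtain s where run: "dd_run n q H g b is_int L slo shi D s n {}"
      using assms(6) by (auto simp: relaxed_dd_def)
    have "\<exists>u. tracks n q H g x D s n u \<and>
        ((u, jx n) \<in> {} \<or> (\<exists>v. tracks n q H g x D s (Suc n) v))"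
      using x by (intro dd_run_tracks[OF assms(2) run assms(1) jx]) (auto simp: feasible_set_def)
    then obtain v where v: "tracks n q H g x D s (Suc n) v" by blast
    have "node_layer D (n + 1) = {terminal D}"
      by (rule decision_diagramD(8)[OF relaxed_dd_decision_diagram[OF assms(6,1)]])
    with v have "initial_part x (Suc n) \<in> convex hull (Sol D)"
      unfolding Sol_eq_walk_points by (auto simp: tracks_def[OF assms(2)])
    \<comment> \<open>Truncation before \<open>Suc n\<close> loses nothing, as feasible vectors
      vanish beyond \<open>n\<close>.\<close>
    moreover have "initial_part x (Suc n) = x"
      using x by (auto simp: initial_part_def feasible_set_def fun_eq_iff)
    ultimately show "x \<in> convex hull (Sol D)" by simp
  qed
qed (rule convex_convex_hull)

end
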